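(* Let $d = lev_{\gamma,\theta}$ (with $\gamma,\theta>0$) be an arbitrary generalized Levenshtein distance. Then there exists a regular language $L$ such that $Isom_d(L)\cong\prod_{n=1}^\infty S_{2n}$.
   Context: For a finite alphabet $A$, $A^*$ is the set of all finite words over $A$ (including the empty word), and a language is a subset of $A^*$. A regular language is a language (over a finite alphabet) that can be obtained from finite languages by finitely many applications of union, product $UV=\{uv \mid u\in U, v\in V\}$ and Kleene star $U^*=\bigcup_{n=0}^\infty U^n$. For real $\gamma,\theta>0$ the generalized Levenshtein distance with insertion (equivalently, removal) weight $\gamma$ and replacement weight $\theta$ is $$lev_{\gamma,\theta}(u,v)=\min\{\gamma n+\theta m \mid u \text{ can be transformed into } v \text{ by } n \text{ insertions or deletions of single characters and } m \text{ replacements of single characters}\}$$ where the intermediate words are arbitrary words of $A^*$. It is a metric on $A^*$. $Isom_d(L)$ is the group (under composition) of all bijections $\phi:L\to L$ with $d(\phi(u),\phi(v))=d(u,v)$ for all $u,v\in L$. $S_m$ is the symmetric group on $m$ elements and $\prod$ denotes the (unrestricted) Cartesian product of groups. *)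

theory Defs
  imports Complex_Main "HOL-Algebra.Bij" "HOL-Algebra.Sym_Groups" "HOL-Algebra.Product_Groups"
begin

text \<open>
  A word over an alphabet \<open>A\<close> is an element of \<open>lists A\<close>. The alphabet is an explicit set rather
  than a type, so that "there is a finite alphabet" can be said inside a formula.
\<close>

definition lang_prod :: "'a list set \<Rightarrow> 'a list set \<Rightarrow> 'a list set" where
  "lang_prod U V = {u @ v | u v. u \<in> U \<and> v \<in> V}"

primrec lang_pow :: "'a list set \<Rightarrow> nat \<Rightarrow> 'a list set" where
  "lang_pow U 0 = {[]}"
| "lang_pow U (Suc n) = lang_prod U (lang_pow U n)"

definition lang_star :: "'a list set \<Rightarrow> 'a list set" where
  "lang_star U = (\<Union>n. lang_pow U n)"

inductive regular_language :: "'a set \<Rightarrow> 'a list set \<Rightarrow> bool" for A where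
  finite_lang: "finite U \<Longrightarrow> U \<subseteq> lists A \<Longrightarrow> regular_language A U"
| union: "regular_language A U \<Longrightarrow> regular_language A V \<Longrightarrow> regular_language A (U \<union> V)"
| product: "regular_language A U \<Longrightarrow> regular_language A V \<Longrightarrow> regular_language A (lang_prod U V)"
| star: "regular_language A U \<Longrightarrow> regular_language A (lang_star U)"

text \<open>
  \<open>transforms A u v n m\<close>: \<open>u\<close> is turned into \<open>v\<close> by a sequence of edits, in any order, with exactly
  \<open>n\<close> insertions or deletions and \<open>m\<close> replacements, all intermediate words lying in \<open>lists A\<close>.
\<close>

inductive transforms :: "'a set \<Rightarrow> 'a list \<Rightarrow> 'a list \<Rightarrow> nat \<Rightarrow> nat \<Rightarrow> bool" for A where
  refl: "u \<in> lists A \<Longrightarrow> transforms A u u 0 0"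
| insertion: "transforms A u (x @ y) n m \<Longrightarrow> a \<in> A \<Longrightarrow> transforms A u (x @ [a] @ y) (Suc n) m"
| deletion: "transforms A u (x @ [a] @ y) n m \<Longrightarrow> transforms A u (x @ y) (Suc n) m"
| replacement: "transforms A u (x @ [a] @ y) n m \<Longrightarrow> b \<in> A
    \<Longrightarrow> transforms A u (x @ [b] @ y) n (Suc m)"

text \<open>
  On reals, \<open>LEAST\<close> denotes the minimum of the set of costs; the lemma \<open>lev_attained\<close> below shows
  that this minimum exists for words over \<open>A\<close>.
\<close>

definition lev :: "'a set \<Rightarrow> real \<Rightarrow> real \<Rightarrow> 'a list \<Rightarrow> 'a list \<Rightarrow> real" where
  "lev A \<gamma> \<theta> u v = (LEAST c. \<exists>n m. c = \<gamma> * real n + \<theta> * real m \<and> transforms A u v n m)"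

text \<open>
  The bijections in \<open>BijGroup L\<close> are extensional (\<open>undefined\<close> outside \<open>L\<close>), so that each bijection
  of \<open>L\<close> is represented exactly once.
\<close>

definition isom_group :: "('a \<Rightarrow> 'a \<Rightarrow> real) \<Rightarrow> 'a set \<Rightarrow> ('a \<Rightarrow> 'a) monoid" where
  "isom_group d L =
    (BijGroup L)\<lparr>carrier := {\<phi> \<in> Bij L. \<forall>u\<in>L. \<forall>v\<in>L. d (\<phi> u) (\<phi> v) = d u v}\<rparr>"

lemma transforms_in_lists:
  assumes "transforms A u v n m"
  shows "u \<in> lists A" "v \<in> lists A"
  using assms by (induction rule: transforms.induct) auto

lemma lang_prod_subset: "U \<subseteq> lists A \<Longrightarrow> V \<subseteq> lists A \<Longrightarrow> lang_prod U V \<subseteq> lists A"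
  by (fastforce simp: lang_prod_def)

lemma regular_language_subset: "regular_language A L \<Longrightarrow> L \<subseteq> lists A"
proof (induction rule: regular_language.induct)
  case (star U)
  have "lang_pow U n \<subseteq> lists A" for n
    using star.IH by (induction n) (simp_all add: lang_prod_subset)
  then show ?case by (auto simp: lang_star_def)
qed (simp_all add: lang_prod_subset)

lemma transforms_exists:
  assumes "u \<in> lists A" "v \<in> lists A"
  shows "\<exists>n m. transforms A u v n m"
proof -
  have del: "\<exists>n. transforms A u (drop k u) n 0" if "k \<le> length u" for k
    using that
  proof (induction k)
    case 0
    then show ?case using transforms.refl[OF assms(1)] by auto
  next
    case (Suc k)
    then obtain n where "transforms A u (drop k u) n 0" by auto
    moreover have "drop k u = [] @ [u ! k] @ drop (Suc k) u"
      using Suc.prems by (simp add: Cons_nth_drop_Suc)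
    ultimately have "transforms A u ([] @ drop (Suc k) u) (Suc n) 0"
      by (metis transforms.deletion)
    then show ?case by auto
  qed
  from del[of "length u"] obtain n where n: "transforms A u [] n 0" by auto
  have "\<exists>n. transforms A u v n 0"
    using assms(2)
  proof (induction v)
    case Nil
    then show ?case using n by blast
  next
    case (Cons a v)
    then obtain k where "transforms A u ([] @ v) k 0" by auto
    then have "transforms A u ([] @ [a] @ v) (Suc k) 0"
      using Cons.hyps by (intro transforms.insertion) auto
    then show ?case by auto
  qed
  then show ?thesis by blast
qed

lemma lev_attained:
  assumes "\<gamma> > 0" "\<theta> > 0" "u \<in> lists A" "v \<in> lists A"
  shows "\<exists>n m. lev A \<gamma> \<theta> u v = \<gamma> * real n + \<theta> * real m \<and> transforms A u v n m"
    and "\<And>n m. transforms A u v n m \<Longrightarrow> lev A \<gamma> \<theta> u v \<le> \<gamma> * real n + \<theta> * real m"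
proof -
  define P where "P c \<longleftrightarrow> (\<exists>n m. c = \<gamma> * real n + \<theta> * real m \<and> transforms A u v n m)" for c
  obtain n0 m0 where nm: "transforms A u v n0 m0" using transforms_exists[OF assms(3,4)] by blast
  define c0 where "c0 = \<gamma> * real n0 + \<theta> * real m0"
  have P0: "P c0" using nm by (auto simp: P_def c0_def)
  have "{c. P c \<and> c \<le> c0} \<subseteq>
      (\<lambda>(n, m). \<gamma> * real n + \<theta> * real m) ` ({..nat \<lceil>c0 / \<gamma>\<rceil>} \<times> {..nat \<lceil>c0 / \<theta>\<rceil>})"
  proof
    fix c assume "c \<in> {c. P c \<and> c \<le> c0}"
    then obtain n m where c: "c = \<gamma> * real n + \<theta> * real m" "c \<le> c0" by (auto simp: P_def)
    have "0 \<le> \<gamma> * real n" "0 \<le> \<theta> * real m" using assms(1,2) by auto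
    then have "\<gamma> * real n \<le> c0" "\<theta> * real m \<le> c0" using c by linarith+
    then have "real n \<le> c0 / \<gamma>" "real m \<le> c0 / \<theta>"
      using assms(1,2) by (simp_all add: field_simps)
    then have "n \<le> nat \<lceil>c0 / \<gamma>\<rceil>" "m \<le> nat \<lceil>c0 / \<theta>\<rceil>" by linarith+
    then show "c \<in> (\<lambda>(n, m). \<gamma> * real n + \<theta> * real m) `
        ({..nat \<lceil>c0 / \<gamma>\<rceil>} \<times> {..nat \<lceil>c0 / \<theta>\<rceil>})"
      using c by (auto intro!: image_eqI[of _ _ "(n, m)"])
  qed
  then have fin: "finite {c. P c \<and> c \<le> c0}" by (rule finite_subset) auto
  define c1 where "c1 = Min {c. P c \<and> c \<le> c0}"
  have "c1 \<in> {c. P c \<and> c \<le> c0}" unfolding c1_def using fin P0 by (intro Min_in) auto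
  then have P1: "P c1" "c1 \<le> c0" by auto
  have min: "c1 \<le> c" if "P c" for c
  proof (cases "c \<le> c0")
    case True
    then show ?thesis unfolding c1_def using fin that by (intro Min_le) auto
  qed (use P1 in auto)
  have eq: "lev A \<gamma> \<theta> u v = c1"
    unfolding lev_def P_def[symmetric] using P1(1) min by (rule Least_equality)
  show "\<exists>n m. lev A \<gamma> \<theta> u v = \<gamma> * real n + \<theta> * real m \<and> transforms A u v n m"
    using P1(1) unfolding eq P_def .
  show "lev A \<gamma> \<theta> u v \<le> \<gamma> * real n + \<theta> * real m" if "transforms A u v n m" for n m
    unfolding eq using that by (intro min) (auto simp: P_def)
qed

lemma group_isom_group: "group (isom_group d L)"
proof -
  let ?I = "{\<phi> \<in> Bij L. \<forall>u\<in>L. \<forall>v\<in>L. d (\<phi> u) (\<phi> v) = d u v}"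
  interpret group "BijGroup L" by (rule group_BijGroup)
  have mem: "f x \<in> L" if "f \<in> Bij L" "x \<in> L" for f x
    using that Bij_imp_funcset by blast
  have "subgroup ?I (BijGroup L)"
  proof (rule subgroupI)
    show "?I \<subseteq> carrier (BijGroup L)" by (auto simp: BijGroup_def)
    show "?I \<noteq> {}" using id_Bij[of L] by force
  next
    fix f assume f: "f \<in> ?I"
    have "restrict (inv_into L f) L \<otimes>\<^bsub>BijGroup L\<^esub> f = \<one>\<^bsub>BijGroup L\<^esub>"
      using f by (simp add: BijGroup_def restrict_inv_into_Bij Bij_compose_restrict_eq)
    then have inv: "inv\<^bsub>BijGroup L\<^esub> f = restrict (inv_into L f) L"
      using f by (intro inv_equality) (auto simp: BijGroup_def restrict_inv_into_Bij)
    have "d (inv_into L f u) (inv_into L f v) = d u v" if "u \<in> L" "v \<in> L" for u v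
    proof -
      have "f ` L = L" using f by (auto simp: Bij_def bij_betw_def)
      then have "f (inv_into L f u) = u" "f (inv_into L f v) = v"
        "inv_into L f u \<in> L" "inv_into L f v \<in> L"
        using that by (auto intro: f_inv_into_f inv_into_into)
      with f show ?thesis by fastforce
    qed
    then show "inv\<^bsub>BijGroup L\<^esub> f \<in> ?I"
      using f by (simp add: inv restrict_inv_into_Bij)
  next
    fix f g assume "f \<in> ?I" "g \<in> ?I"
    then show "f \<otimes>\<^bsub>BijGroup L\<^esub> g \<in> ?I"
      by (auto simp: BijGroup_def compose_Bij compose_eq mem)
  qed
  then show ?thesis
    unfolding isom_group_def by (rule subgroup_imp_group)
qed

end

theory Submission
  imports Defs "HOL-Library.Sublist"
begin

text \<open>
  Let \<open>w = 0 1 \<dots> (p - 1)\<close> with \<open>p \<ge> 2\<close> and \<open>p * \<theta> \<ge> 2 * \<gamma>\<close>, and let \<open>L\<close> consist of the words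
  obtained from some \<open>w\<^sup>2\<^sup>n\<close>, \<open>n \<ge> 1\<close>, by erasing the last letter of one of the copies of \<open>w\<close>.
  Two words from the same \<open>w\<^sup>2\<^sup>n\<close> differ in at least \<open>p\<close> positions, so replacements alone are too
  expensive and their distance is \<open>2 * \<gamma>\<close>. If \<open>n < m\<close>, a word from \<open>w\<^sup>2\<^sup>n\<close> is a subsequence of
  every word from \<open>w\<^sup>2\<^sup>m\<close>, because it embeds in \<open>w\<^sup>2\<^sup>n\<close>, which embeds in a \<open>w\<^sup>2\<^sup>m\<close> with one copy of
  \<open>w\<close> removed; hence their distance \<open>2 * p * \<gamma> * (m - n) > 2 * \<gamma>\<close> depends only on \<open>n\<close> and \<open>m\<close>.
  So the blocks are the classes of the relation \<open>d u v \<le> 2 * \<gamma>\<close>, which isometries preserve; as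
  the sizes \<open>2 * n\<close> are distinct, an isometry is an arbitrary choice of a permutation of each block.
\<close>

section \<open>Edit sequences: composition, embeddings, lower bounds\<close>

lemma transforms_trans:
  assumes "transforms A v w n' m'" "transforms A u v n m"
  shows "transforms A u w (n + n') (m + m')"
  using assms
proof (induction rule: transforms.induct)
  case (insertion v x y n' m' a)
  then show ?case using transforms.insertion[of A u x y] by simp
next
  case (deletion v x a y n' m')
  then show ?case using transforms.deletion[of A u x a y] by simp
next
  case (replacement v x a y n' m' b)
  then show ?case using transforms.replacement[of A u x a y] by simp
qed simp

lemma transforms_Cons:
  assumes "transforms A u v n m" "c \<in> A"
  shows "transforms A (c # u) (c # v) n m"
  using assms
proof (induction rule: transforms.induct)
  case (refl u)
  then show ?case by (intro transforms.refl) simp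
next
  case (insertion u x y n m a)
  then show ?case using transforms.insertion[of A "c # u" "c # x" y n m a] by simp
next
  case (deletion u x a y n m)
  then show ?case using transforms.deletion[of A "c # u" "c # x" a y n m] by simp
next
  case (replacement u x a y n m b)
  then show ?case using transforms.replacement[of A "c # u" "c # x" a y n m b] by simp
qed

text \<open>Each letter outside the embedding costs one insertion in one direction and one deletion
  in the other. For the deletion, the leading letter is carried along by
  \<open>transforms_Cons\<close> and removed last.\<close>

lemma transforms_subseq:
  assumes "subseq u v" "v \<in> lists A"
  shows "transforms A u v (length v - length u) 0" "transforms A v u (length v - length u) 0"
proof -
  have "transforms A u v (length v - length u) 0 \<and> transforms A v u (length v - length u) 0"
    using assms
  proof (induction rule: list_emb.induct)
    case (list_emb_Nil ys)
    then show ?case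
    proof (induction ys)
      case (Cons y ys)
      then have "transforms A ([] @ [y] @ ys) ([] @ [y]) (length ys) 0"
        using transforms_Cons[of A ys "[]" _ 0 y] by auto
      then have "transforms A (y # ys) [] (Suc (length ys)) 0"
        using transforms.deletion[of A "y # ys" "[]" y "[]"] by simp
      then show ?case
        using Cons transforms.insertion[of A "[]" "[]" ys "length ys" 0 y] by simp
    qed (simp add: transforms.refl)
  next
    case (list_emb_Cons xs ys y)
    then have y: "y \<in> A" and t: "transforms A xs ys (length ys - length xs) 0"
      "transforms A ys xs (length ys - length xs) 0" by auto
    have "Suc (length ys) - length xs = Suc (length ys - length xs)"
      using list_emb_length[OF list_emb_Cons(1)] by simp
    moreover have "transforms A xs (y # ys) (Suc (length ys - length xs)) 0"
      using transforms.insertion[of A xs "[]" ys _ 0 y] t y by simp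
    moreover have "transforms A (y # ys) xs (Suc (length ys - length xs)) 0"
      using transforms.deletion[of A "y # ys" "[]" y xs] transforms_Cons[OF t(2) y] by simp
    ultimately show ?case by simp
  next
    case (list_emb_Cons2 x y xs ys)
    then show ?case by (auto intro: transforms_Cons)
  qed
  then show "transforms A u v (length v - length u) 0" "transforms A v u (length v - length u) 0"
    by auto
qed

text \<open>Only insertions and deletions change the length, each by one. The parity clause rules
  out \<open>n = 1\<close> between words of equal length.\<close>

lemma transforms_length:
  assumes "transforms A u v n m"
  shows "length v \<le> length u + n" "length u \<le> length v + n" "even (length u + length v + n)"
  using assms by (induction rule: transforms.induct) auto

text \<open>Without insertions and deletions positions stay aligned, and a replacement affects a
  single one.\<close>

lemma transforms_hamming:
  assumes "transforms A u v 0 m"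
  shows "card {t. t < length u \<and> u ! t \<noteq> v ! t} \<le> m"
proof -
  have "card {t. t < length u \<and> u ! t \<noteq> v ! t} \<le> m" if "transforms A u v n m" "n = 0" for n
    using that
  proof (induction rule: transforms.induct)
    case (replacement u x a y n m b)
    have "{t. t < length u \<and> u ! t \<noteq> (x @ [b] @ y) ! t}
        \<subseteq> insert (length x) {t. t < length u \<and> u ! t \<noteq> (x @ [a] @ y) ! t}"
      by (auto simp: nth_append nth_Cons split: if_splits nat.splits)
    then have "card {t. t < length u \<and> u ! t \<noteq> (x @ [b] @ y) ! t}
        \<le> card (insert (length x) {t. t < length u \<and> u ! t \<noteq> (x @ [a] @ y) ! t})"
      by (intro card_mono) auto
    also have "\<dots> \<le> Suc (card {t. t < length u \<and> u ! t \<noteq> (x @ [a] @ y) ! t})"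
      by (simp add: card_insert_if)
    finally show ?case using replacement by linarith
  qed auto
  then show ?thesis using assms by blast
qed

section \<open>Edit distance along subsequences and between words of equal length\<close>

text \<open>Every edit sequence has at least as many insertions and deletions as the lengths differ
  by, and the embedding attains this without replacements. Covering both orders of the arguments
  avoids a symmetry argument for \<open>lev\<close>.\<close>

lemma lev_subseq:
  assumes "\<gamma> > 0" "\<theta> > 0" "subseq u v" "v \<in> lists A"
  shows "lev A \<gamma> \<theta> u v = \<gamma> * real (length v - length u)"
    and "lev A \<gamma> \<theta> v u = \<gamma> * real (length v - length u)"
proof -
  note t = transforms_subseq[OF assms(3,4)]
  have u: "u \<in> lists A" using transforms_in_lists(1)[OF t(1)] .
  have bound: "\<gamma> * real (length v - length u) \<le> \<gamma> * real n + \<theta> * real m"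
    if "length v - length u \<le> n" for n m
  proof -
    have "\<gamma> * real (length v - length u) \<le> \<gamma> * real n" using that assms(1) by simp
    moreover have "0 \<le> \<theta> * real m" using assms(2) by simp
    ultimately show ?thesis by linarith
  qed
  obtain n m where "lev A \<gamma> \<theta> u v = \<gamma> * real n + \<theta> * real m" "transforms A u v n m"
    using lev_attained(1)[OF assms(1,2) u assms(4)] by blast
  moreover from this have "length v - length u \<le> n" using transforms_length(1) by fastforce
  ultimately show "lev A \<gamma> \<theta> u v = \<gamma> * real (length v - length u)"
    using bound lev_attained(2)[OF assms(1,2) u assms(4) t(1)] by (simp add: order_antisym)
  obtain n m where "lev A \<gamma> \<theta> v u = \<gamma> * real n + \<theta> * real m" "transforms A v u n m"
    using lev_attained(1)[OF assms(1,2) assms(4) u] by blast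
  moreover from this have "length v - length u \<le> n" using transforms_length(2) by fastforce
  ultimately show "lev A \<gamma> \<theta> v u = \<gamma> * real (length v - length u)"
    using bound lev_attained(2)[OF assms(1,2) assms(4) u t(2)] by (simp add: order_antisym)
qed

lemma lev_self:
  assumes "\<gamma> > 0" "\<theta> > 0" "u \<in> lists A"
  shows "lev A \<gamma> \<theta> u u = 0"
  using lev_subseq(1)[OF assms(1,2) _ assms(3), of u] by simp

text \<open>The route through \<open>z\<close> costs one insertion and one deletion. For the lower
  bound, equal lengths make \<open>n\<close> even: \<open>n = 0\<close> leaves only replacements,
  too expensive by \<open>hamming\<close>, and otherwise \<open>n\<close> is at least 2.\<close>

lemma lev_eq_length:
  assumes "\<gamma> > 0" "\<theta> > 0" "z \<in> lists A" "subseq u z" "subseq v z"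
    and "length z = Suc (length u)" "length z = Suc (length v)"
    and hamming: "2 * \<gamma> \<le> \<theta> * real (card {t. t < length u \<and> u ! t \<noteq> v ! t})"
  shows "lev A \<gamma> \<theta> u v = 2 * \<gamma>"
proof -
  have t: "transforms A u v 2 0"
    using transforms_trans[OF transforms_subseq(2)[OF assms(5,3)] transforms_subseq(1)[OF assms(4,3)]]
      assms(6,7) by (simp add: numeral_2_eq_2)
  note uv = transforms_in_lists[OF t]
  obtain n m where nm: "lev A \<gamma> \<theta> u v = \<gamma> * real n + \<theta> * real m" "transforms A u v n m"
    using lev_attained(1)[OF assms(1,2) uv] by blast
  have "2 * \<gamma> \<le> \<gamma> * real n + \<theta> * real m"
  proof (cases "n = 0")
    case True
    then have "\<theta> * real (card {t. t < length u \<and> u ! t \<noteq> v ! t}) \<le> \<theta> * real m"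
      using transforms_hamming nm(2) assms(2) by auto
    then show ?thesis using True hamming by simp
  next
    case False
    moreover have "even n" using transforms_length(3)[OF nm(2)] assms(6,7) by simp
    ultimately have "2 \<le> n" by presburger
    then have "\<gamma> * 2 \<le> \<gamma> * real n" using assms(1) by simp
    moreover have "0 \<le> \<theta> * real m" using assms(2) by simp
    ultimately show ?thesis by linarith
  qed
  then show ?thesis using nm(1) lev_attained(2)[OF assms(1,2) uv t] by simp
qed

section \<open>Periodic words with one letter erased\<close>

text \<open>For \<open>p > 0\<close>, a prefix of the infinite word 0 1 ... (p - 1) 0 1 ...;
  indexing by length rather than by number of copies also covers truncated copies.\<close>

definition cyc :: "nat \<Rightarrow> nat \<Rightarrow> nat list" where
  "cyc p l = map (\<lambda>t. t mod p) [0..<l]"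

lemma length_cyc [simp]: "length (cyc p l) = l"
  by (simp add: cyc_def)

lemma cyc_0 [simp]: "cyc p 0 = []"
  by (simp add: cyc_def)

lemma nth_cyc: "t < l \<Longrightarrow> cyc p l ! t = t mod p"
  by (simp add: cyc_def)

text \<open>A shift by \<open>p * a\<close> preserves residues modulo \<open>p\<close>, hence the
  whole number of periods on the left.\<close>

lemma cyc_append: "cyc p (p * a) @ cyc p b = cyc p (p * a + b)"
proof -
  have "cyc p b = map (\<lambda>t. t mod p) (map (\<lambda>t. t + p * a) [0..<b])"
    by (simp add: cyc_def)
  also have "\<dots> = map (\<lambda>t. t mod p) [p * a..<p * a + b]"
    by (simp only: map_add_upt add.commute)
  finally show ?thesis
    by (simp add: cyc_def upt_add_eq_append[of 0])
qed

lemma cyc_append_append: "cyc p (p * a) @ cyc p b @ v = cyc p (p * a + b) @ v"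
  by (metis append_assoc cyc_append)

lemma prefix_cyc: "a \<le> b \<Longrightarrow> prefix (cyc p a) (cyc p b)"
  unfolding cyc_def using upt_add_eq_append[of 0 a "b - a"] by simp

lemma cyc_in_lists: "0 < p \<Longrightarrow> cyc p l \<in> lists {..<p}"
  by (auto simp: cyc_def)

text \<open>
  The period \<open>0 1 \<dots> (p - 1)\<close> repeated \<open>2 * n\<close> times, with the last letter of the \<open>k\<close>-th copy erased
  (\<open>1 \<le> k \<le> 2 * n\<close>).
\<close>

definition dent :: "nat \<Rightarrow> nat \<Rightarrow> nat \<Rightarrow> nat list" where
  "dent p n k = cyc p (p * k - 1) @ cyc p (p * (2 * n - k))"

lemma dent_in_lists: "0 < p \<Longrightarrow> dent p n k \<in> lists {..<p}"
  using cyc_in_lists by (simp add: dent_def)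

lemma length_dent:
  assumes "0 < p" "k \<in> {1..2 * n}"
  shows "length (dent p n k) = p * (2 * n) - 1"
proof -
  \<comment> \<open>As \<open>p * k\<close> is positive, the subtraction in \<open>p * k - 1\<close>
    is not truncated.\<close>
  have "1 \<le> p * k" "p * k + p * (2 * n - k) = p * (2 * n)"
    using assms by (auto simp flip: add_mult_distrib2)
  then show ?thesis by (simp add: dent_def)
qed

lemma dent_subseq_cyc:
  assumes "k \<in> {1..2 * n}"
  shows "subseq (dent p n k) (cyc p (p * (2 * n)))"
proof -
  have "cyc p (p * (2 * n)) = cyc p (p * k) @ cyc p (p * (2 * n - k))"
    unfolding cyc_append using assms by (simp flip: add_mult_distrib2)
  then show ?thesis
    unfolding dent_def by (auto intro!: list_emb_append_mono prefix_imp_subseq prefix_cyc)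
qed

text \<open>Erasing the rest of the damaged copy too leaves \<open>2 * n - 1\<close> whole
  copies.\<close>

lemma cyc_subseq_dent:
  assumes "0 < p" "k \<in> {1..2 * n}"
  shows "subseq (cyc p (p * (2 * n - 1))) (dent p n k)"
proof -
  have "cyc p (p * (2 * n - 1)) = cyc p (p * (k - 1)) @ cyc p (p * (2 * n - k))"
    unfolding cyc_append using assms by (simp flip: add_mult_distrib2)
  moreover have "p * (k - 1) \<le> p * k - 1"
    using assms by (cases k) auto
  ultimately show ?thesis
    unfolding dent_def by (auto intro!: list_emb_append_mono prefix_imp_subseq prefix_cyc)
qed

lemma dent_subseq_dent:
  assumes "0 < p" "k \<in> {1..2 * n}" "l \<in> {1..2 * m}" "n < m"
  shows "subseq (dent p n k) (dent p m l)"
proof -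
  have "subseq (cyc p (p * (2 * n))) (cyc p (p * (2 * m - 1)))"
    using assms(4) by (intro prefix_imp_subseq prefix_cyc mult_le_mono2) linarith
  then show ?thesis
    using dent_subseq_cyc[OF assms(2)] cyc_subseq_dent[OF assms(1,3)]
    by (meson subseq_order.trans)
qed

text \<open>Past the gap every letter sits one position earlier than in the intact periodic
  word.\<close>

lemma nth_dent:
  assumes "0 < p" "k \<in> {1..2 * n}" "t < p * (2 * n) - 1"
  shows "dent p n k ! t = (if t < p * k - 1 then t mod p else Suc t mod p)"
proof (cases "t < p * k - 1")
  case False
  have k: "1 \<le> p * k" "p * k + p * (2 * n - k) = p * (2 * n)"
    using assms by (auto simp flip: add_mult_distrib2)
  then obtain s where s: "Suc t = p * k + s" using False le_Suc_ex[of "p * k" "Suc t"] by force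
  then have "t - (p * k - 1) = s" "s < p * (2 * n - k)" using k assms(3) by linarith+
  then show ?thesis using False s by (simp add: dent_def nth_append nth_cyc)
qed (simp add: dent_def nth_append nth_cyc)

text \<open>For \<open>k < l\<close>, the \<open>p\<close> positions from \<open>p * k - 1\<close>
  on lie past the gap of the first word and before that of the second. They compare t + 1 with t
  modulo \<open>p\<close>, which differ as \<open>p\<close> is at least 2.\<close>

lemma dent_hamming:
  assumes "2 \<le> p" "k \<in> {1..2 * n}" "l \<in> {1..2 * n}" "k \<noteq> l"
  shows "p \<le> card {t. t < length (dent p n k) \<and> dent p n k ! t \<noteq> dent p n l ! t}"
proof -
  have 1: "p \<le> card {t. t < p * (2 * n) - 1 \<and> dent p n k ! t \<noteq> dent p n l ! t}"
    if kl: "k \<in> {1..2 * n}" "l \<in> {1..2 * n}" "k < l" for k l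
  proof -
    have le: "p * k + p \<le> p * l" "p * l \<le> p * (2 * n)" "1 \<le> p * k"
      using kl assms(1) mult_le_mono2[of "Suc k" l p] by auto
    have "t < p * (2 * n) - 1 \<and> dent p n k ! t \<noteq> dent p n l ! t"
      if "t \<in> {p * k - 1..<p * k - 1 + p}" for t
    proof -
      have "\<not> t < p * k - 1" "t < p * l - 1" "t < p * (2 * n) - 1"
        using that le unfolding atLeastLessThan_iff by linarith+
      moreover have "t mod p \<noteq> Suc t mod p" using assms(1) by (simp add: mod_Suc)
      ultimately show ?thesis using kl assms(1) by (simp add: nth_dent)
    qed
    then have "{p * k - 1..<p * k - 1 + p} \<subseteq>
        {t. t < p * (2 * n) - 1 \<and> dent p n k ! t \<noteq> dent p n l ! t}" by blast
    then have "card {p * k - 1..<p * k - 1 + p}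
        \<le> card {t. t < p * (2 * n) - 1 \<and> dent p n k ! t \<noteq> dent p n l ! t}"
      by (intro card_mono) auto
    then show ?thesis by simp
  qed
  show ?thesis
  proof (cases "k < l")
    case True
    then show ?thesis using 1[of k l] assms by (simp add: length_dent)
  next
    case False
    then have "l < k" using assms(4) by simp
    then show ?thesis
      using 1[of l k] assms by (simp add: length_dent eq_commute[of "dent p n k ! _"])
  qed
qed

text \<open>Brings the distances into the form that \<open>isom_group_blocks\<close> expects:
  \<open>k\<close> and \<open>l\<close> matter only through \<open>k = l\<close>, and only if
  \<open>n = m\<close>.\<close>

lemma lev_dent:
  assumes "\<gamma> > 0" "\<theta> > 0" "2 \<le> p" "2 * \<gamma> \<le> \<theta> * real p"
    and "k \<in> {1..2 * n}" "l \<in> {1..2 * m}"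
  shows "lev {..<p} \<gamma> \<theta> (dent p n k) (dent p m l) =
    (if n = m then if k = l then 0 else 2 * \<gamma> else 2 * \<gamma> * real p * \<bar>real n - real m\<bar>)"
proof -
  have p: "0 < p" using assms by simp
  note in_lists = dent_in_lists[OF p]
  \<comment> \<open>Each of the two words lacks one letter, so the missing letters cancel in the
    difference.\<close>
  have len: "real (length (dent p j b) - length (dent p i a)) = 2 * real p * (real j - real i)"
    if "i < j" "a \<in> {1..2 * i}" "b \<in> {1..2 * j}" for i j a b
  proof -
    have "p * (2 * i) \<le> p * (2 * j)" "1 \<le> p * (2 * i)" using that p by auto
    then show ?thesis using that p by (simp add: length_dent of_nat_diff algebra_simps)
  qed
  consider "n < m" | "m < n" | "n = m" "k = l" | "n = m" "k \<noteq> l" by linarith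
  then show ?thesis
  proof cases
    case 1
    then show ?thesis
      using lev_subseq(1)[OF assms(1,2) dent_subseq_dent in_lists] len assms p by simp
  next
    case 2
    then show ?thesis
      using lev_subseq(2)[OF assms(1,2) dent_subseq_dent in_lists] len assms p by simp
  next
    case 3
    then show ?thesis using lev_self[OF assms(1,2) in_lists] by simp
  next
    case 4
    \<comment> \<open>This makes \<open>cyc p (p * (2 * n))\<close>, the common supersequence,
      exactly one letter longer than both words.\<close>
    have "1 \<le> p * (2 * n)" using p assms(5) by simp
    moreover have "2 * \<gamma> \<le> \<theta> * real (card
        {t. t < length (dent p n k) \<and> dent p n k ! t \<noteq> dent p n l ! t})"
      using dent_hamming[of p k n l] assms 4
      by (intro order_trans[OF assms(4)] mult_left_mono) auto
    ultimately have "lev {..<p} \<gamma> \<theta> (dent p n k) (dent p n l) = 2 * \<gamma>"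
      using assms 4 p
      by (intro lev_eq_length[OF assms(1,2) cyc_in_lists, where l1 = "p * (2 * n)"])
        (simp_all add: length_dent dent_subseq_cyc)
    then show ?thesis using 4 by simp
  qed
qed

section \<open>Regularity of the language\<close>

lemma lang_star_cyc: "lang_star {cyc p (p * a)} = range (\<lambda>i. cyc p (p * (a * i)))"
proof -
  have "lang_pow {cyc p (p * a)} i = {cyc p (p * (a * i))}" for i
    by (induction i) (simp_all add: lang_prod_def cyc_append add_mult_distrib2)
  then show ?thesis by (auto simp: lang_star_def)
qed

text \<open>Copies are grouped in pairs, which keeps their number even: one pair is damaged, in its
  first or its second copy, and any number of intact pairs precede and follow it.\<close>

lemma dent_language:
  assumes "0 < p"
  shows "(\<lambda>(n, k). dent p n k) ` (SIGMA n:{1..}. {1..2 * n}) =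
    lang_prod (lang_star {cyc p (p * 2)})
      (lang_prod {cyc p (p - 1) @ cyc p p, cyc p (p + (p - 1))} (lang_star {cyc p (p * 2)}))"
    (is "?L = ?R")
proof (intro equalityI subsetI)
  have e: "cyc p (p * (2 * i)) @ cyc p (p - 1) @ cyc p p @ cyc p (p * (2 * j))
        = dent p (i + j + 1) (2 * i + 1)"
      "cyc p (p * (2 * i)) @ cyc p (p + (p - 1)) @ cyc p (p * (2 * j))
        = dent p (i + j + 1) (2 * i + 2)" for i j
  proof -
    have "cyc p p @ cyc p (p * (2 * j)) = cyc p (p * (2 * j + 1))"
      using cyc_append[of p 1 "p * (2 * j)"] by simp
    moreover have a: "p * (2 * i) + (p - 1) = p * (2 * i + 1) - 1"
      "p * (2 * i) + (p + (p - 1)) = p * (2 * i + 2) - 1"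
      using assms by (simp_all add: algebra_simps)
    moreover have b: "2 * (i + j + 1) - (2 * i + 1) = 2 * j + 1"
      "2 * (i + j + 1) - (2 * i + 2) = 2 * j" by simp_all
    ultimately show "cyc p (p * (2 * i)) @ cyc p (p - 1) @ cyc p p @ cyc p (p * (2 * j))
        = dent p (i + j + 1) (2 * i + 1)"
      unfolding dent_def by (simp only: cyc_append_append)
    show "cyc p (p * (2 * i)) @ cyc p (p + (p - 1)) @ cyc p (p * (2 * j))
        = dent p (i + j + 1) (2 * i + 2)"
      unfolding dent_def cyc_append_append a b ..
  qed
  {
    fix u assume "u \<in> ?R"
    then obtain i j v where "u = cyc p (p * (2 * i)) @ v @ cyc p (p * (2 * j))"
      "v = cyc p (p - 1) @ cyc p p \<or> v = cyc p (p + (p - 1))"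
      unfolding lang_prod_def lang_star_cyc by blast
    then have "u = dent p (i + j + 1) (2 * i + 1) \<or> u = dent p (i + j + 1) (2 * i + 2)"
      using e[of i j] by auto
    moreover have "(i + j + 1, 2 * i + 1) \<in> (SIGMA n:{1..}. {1..2 * n})"
      "(i + j + 1, 2 * i + 2) \<in> (SIGMA n:{1..}. {1..2 * n})" by auto
    ultimately show "u \<in> ?L" by (metis (mono_tags, lifting) case_prod_conv image_eqI)
  next
    fix u assume "u \<in> ?L"
    then obtain n k where nk: "u = dent p n k" "1 \<le> k" "k \<le> 2 * n" by auto
    \<comment> \<open>\<open>i\<close> counts the pairs before the one that contains copy
      \<open>k\<close>, and \<open>j\<close> those after it.\<close>
    define i j where "i = (k - 1) div 2" and "j = n - 1 - i"
    have "n = i + j + 1 \<and> (k = 2 * i + 1 \<or> k = 2 * i + 2)"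
      using nk(2,3) unfolding i_def j_def by presburger
    then obtain v where "v = cyc p (p - 1) @ cyc p p \<or> v = cyc p (p + (p - 1))"
      "u = cyc p (p * (2 * i)) @ v @ cyc p (p * (2 * j))"
      using nk(1) e[of i j] by fastforce
    then show "u \<in> ?R"
      unfolding lang_prod_def lang_star_cyc by blast
  }
qed

lemma regular_dent_language:
  assumes "0 < p"
  shows "regular_language {..<p} ((\<lambda>(n, k). dent p n k) ` (SIGMA n:{1..}. {1..2 * n}))"
proof -
  have "regular_language {..<p} {cyc p (p * 2)}"
    "regular_language {..<p} {cyc p (p - 1) @ cyc p p, cyc p (p + (p - 1))}"
    using cyc_in_lists[OF assms]
    by (intro regular_language.finite_lang; simp del: in_lists_conv_set)+
  then show ?thesis
    unfolding dent_language[OF assms]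
    by (intro regular_language.product regular_language.star)
qed

section \<open>Isometries of a set split into equidistant blocks\<close>

text \<open>Separates the group theory from words. A family of permutations acts by sending
  \<open>f n k\<close> to \<open>f n (\<sigma> n k)\<close>; this preserves \<open>d\<close>, which
  sees only equality within a block and only block numbers across blocks.\<close>

lemma isom_group_blocks:
  fixes f :: "nat \<Rightarrow> nat \<Rightarrow> 'a" and s :: real
  assumes d: "\<And>n k m l. \<lbrakk>k \<in> {1..2 * n}; l \<in> {1..2 * m}\<rbrakk> \<Longrightarrow>
      d (f n k) (f m l) = (if n = m then if k = l then 0 else s else t n m)"
    and s: "0 < s" and t: "\<And>n m. n \<noteq> m \<Longrightarrow> s < t n m"
  defines "L \<equiv> (\<lambda>(n, k). f n k) ` (SIGMA n:{1..}. {1..2 * n})"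
  shows "isom_group d L \<cong> product_group {1..} (\<lambda>n. sym_group (2 * n))"
proof -
  let ?P = "product_group {1..} (\<lambda>n. sym_group (2 * n))"
  have L_cases: "\<exists>n k. u = f n k \<and> 1 \<le> n \<and> k \<in> {1..2 * n}" if u: "u \<in> L" for u
  proof -
    obtain n k where "u = f n k" "k \<in> {1..2 * n}" using u by (auto simp: L_def)
    moreover from this have "1 \<le> n" by auto
    ultimately show ?thesis by blast
  qed
  have L_intro: "f n k \<in> L" if "k \<in> {1..2 * n}" for n k
    using that by (auto simp: L_def intro!: image_eqI[where x = "(n, k)"])
  have near: "d (f n k) (f m l) \<le> s \<longleftrightarrow> n = m"
    if "k \<in> {1..2 * n}" "l \<in> {1..2 * m}" for n k m l
    using d[OF that] s t[of n m] by auto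
  \<comment> \<open>Injectivity is read off the distances: 0 occurs only for equal indices, since
    \<open>s\<close> is positive and \<open>t n m\<close> exceeds it for
    \<open>n \<noteq> m\<close>.\<close>
  have f_eq: "f n k = f m l \<longleftrightarrow> n = m \<and> k = l"
    if "k \<in> {1..2 * n}" "l \<in> {1..2 * m}" for n k m l
    using d[OF that] d[OF that(1) that(1)] s t[of n m] by (auto split: if_splits)
  define ind where "ind u = (SOME (n, k). u = f n k \<and> k \<in> {1..2 * n})" for u
  have ind: "ind (f n k) = (n, k)" if "k \<in> {1..2 * n}" for n k
    unfolding ind_def by (rule some_equality) (use that f_eq in auto)
  define h where "h \<sigma> = (\<lambda>u\<in>L. f (fst (ind u)) (\<sigma> (fst (ind u)) (snd (ind u))))"
    for \<sigma> :: "nat \<Rightarrow> nat \<Rightarrow> nat"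
  have h: "h \<sigma> (f n k) = f n (\<sigma> n k)" if "k \<in> {1..2 * n}" for \<sigma> n k
    using that by (simp add: h_def L_intro ind)
  have perm: "\<sigma> n permutes {1..2 * n}" if "\<sigma> \<in> carrier ?P" "1 \<le> n" for \<sigma> n
    using that by (auto simp: sym_group_def PiE_iff)
  have perm_in: "\<sigma> n k \<in> {1..2 * n}" if "\<sigma> \<in> carrier ?P" "k \<in> {1..2 * n}" for \<sigma> n k
  proof -
    have "1 \<le> n" using that(2) by auto
    then show ?thesis using permutes_in_image[OF perm[OF that(1)]] that(2) by blast
  qed
  have h_carrier: "h \<sigma> \<in> carrier (isom_group d L)" if \<sigma>: "\<sigma> \<in> carrier ?P" for \<sigma>
  proof -
    have "bij_betw (h \<sigma>) L L"
    proof (rule bij_betw_imageI)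
      show "inj_on (h \<sigma>) L"
      proof (rule inj_onI)
        fix u v assume uv: "u \<in> L" "v \<in> L" "h \<sigma> u = h \<sigma> v"
        obtain n k m l where e: "u = f n k" "1 \<le> n" "k \<in> {1..2 * n}"
          "v = f m l" "1 \<le> m" "l \<in> {1..2 * m}"
          using L_cases[OF uv(1)] L_cases[OF uv(2)] by blast
        then have "f n (\<sigma> n k) = f m (\<sigma> m l)" using uv(3) by (simp add: h)
        then have "n = m" "\<sigma> n k = \<sigma> n l"
          using f_eq[OF perm_in[OF \<sigma> e(3)] perm_in[OF \<sigma> e(6)]] by auto
        moreover from this have "k = l" using permutes_inj[OF perm[OF \<sigma> e(2)]] by (simp add: inj_eq)
        ultimately show "u = v" using e by simp
      qed
      show "h \<sigma> ` L = L"
      proof (intro equalityI subsetI)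
        fix v assume "v \<in> h \<sigma> ` L"
        then obtain u where u: "u \<in> L" "v = h \<sigma> u" by blast
        then obtain n k where "u = f n k" "k \<in> {1..2 * n}" using L_cases by blast
        then show "v \<in> L" using h perm_in[OF \<sigma>] L_intro u(2) by metis
      next
        fix v assume "v \<in> L"
        then obtain n l where v: "v = f n l" "1 \<le> n" "l \<in> {1..2 * n}" using L_cases by blast
        have p: "\<sigma> n permutes {1..2 * n}" using perm[OF \<sigma> v(2)] .
        then have "inv_into UNIV (\<sigma> n) l \<in> {1..2 * n}"
          using v(3) permutes_in_image[OF permutes_inv[OF p]] by blast
        then show "v \<in> h \<sigma> ` L"
          using v p by (intro image_eqI[where x = "f n (inv_into UNIV (\<sigma> n) l)"])
            (simp_all add: h L_intro permutes_inverses del: atLeastAtMost_iff)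
      qed
    qed
    moreover have "d (h \<sigma> u) (h \<sigma> v) = d u v" if uv: "u \<in> L" "v \<in> L" for u v
    proof -
      obtain n k m l where e: "u = f n k" "1 \<le> n" "k \<in> {1..2 * n}"
        "v = f m l" "1 \<le> m" "l \<in> {1..2 * m}"
        using L_cases[OF uv(1)] L_cases[OF uv(2)] by blast
      moreover have "\<sigma> n k = \<sigma> n l \<longleftrightarrow> k = l"
        using permutes_inj[OF perm[OF \<sigma> e(2)]] by (rule inj_eq)
      ultimately show ?thesis
        using d[OF e(3) e(6)] d[OF perm_in[OF \<sigma> e(3)] perm_in[OF \<sigma> e(6)]] by (auto simp: h)
    qed
    ultimately show ?thesis
      by (auto simp: isom_group_def Bij_def h_def)
  qed
  have h_hom: "h \<in> hom ?P (isom_group d L)"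
  proof (rule homI[OF h_carrier])
    fix \<sigma> \<tau> assume \<sigma>: "\<sigma> \<in> carrier ?P" and \<tau>: "\<tau> \<in> carrier ?P"
    have "h (\<sigma> \<otimes>\<^bsub>?P\<^esub> \<tau>) u = compose L (h \<sigma>) (h \<tau>) u" for u
    proof (cases "u \<in> L")
      case True
      then obtain n k where "u = f n k" "1 \<le> n" "k \<in> {1..2 * n}" using L_cases by blast
      then show ?thesis using perm_in[OF \<tau>, of k n]
        by (simp add: h L_intro compose_def sym_group_def del: atLeastAtMost_iff)
    qed (simp add: h_def compose_def)
    then show "h (\<sigma> \<otimes>\<^bsub>?P\<^esub> \<tau>) = h \<sigma> \<otimes>\<^bsub>isom_group d L\<^esub> h \<tau>"
      using h_carrier[OF \<sigma>] h_carrier[OF \<tau>] by (auto simp: isom_group_def BijGroup_def)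
  qed
  have h_inj: "inj_on h (carrier ?P)"
  proof (rule inj_onI)
    fix \<sigma> \<tau> assume \<sigma>: "\<sigma> \<in> carrier ?P" and \<tau>: "\<tau> \<in> carrier ?P" and eq: "h \<sigma> = h \<tau>"
    show "\<sigma> = \<tau>"
    proof (rule PiE_ext)
      show "\<sigma> \<in> (\<Pi>\<^sub>E n\<in>{1..}. carrier (sym_group (2 * n)))"
        "\<tau> \<in> (\<Pi>\<^sub>E n\<in>{1..}. carrier (sym_group (2 * n)))" using \<sigma> \<tau> by simp_all
      fix n :: nat assume "n \<in> {1..}"
      then have n: "1 \<le> n" by simp
      show "\<sigma> n = \<tau> n"
      proof
        fix k
        show "\<sigma> n k = \<tau> n k"
        proof (cases "k \<in> {1..2 * n}")
          case True
          then have "f n (\<sigma> n k) = f n (\<tau> n k)"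
            using h[of k n \<sigma>] h[of k n \<tau>] eq by simp
          then show ?thesis using f_eq[OF perm_in[OF \<sigma> True] perm_in[OF \<tau> True]] by simp
        next
          \<comment> \<open>Permutations are functions on all naturals, so they are also compared
            outside the block, where both are the identity.\<close>
          case False
          then show ?thesis
            using permutes_not_in[OF perm[OF \<sigma> n]] permutes_not_in[OF perm[OF \<tau> n]] by simp
        qed
      qed
    qed
  qed
  have h_surj: "\<phi> \<in> h ` carrier ?P" if "\<phi> \<in> carrier (isom_group d L)" for \<phi>
  proof -
    have ext: "\<phi> \<in> extensional L" and bij: "bij_betw \<phi> L L"
      and iso: "\<And>u v. u \<in> L \<Longrightarrow> v \<in> L \<Longrightarrow> d (\<phi> u) (\<phi> v) = d u v"
      using that by (auto simp: isom_group_def Bij_def)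
    have \<phi>_L: "\<phi> u \<in> L" if "u \<in> L" for u using bij that by (auto simp: bij_betw_def)
    let ?B = "\<lambda>n. f n ` {1..2 * n}"
    have f_bij: "bij_betw (f n) {1..2 * n} (?B n)" for n
      by (intro inj_on_imp_bij_betw inj_onI) (use f_eq in blast)
    have block: "bij_betw \<phi> (?B n) (?B n)" if "1 \<le> n" for n
    proof -
      have n1: "1 \<in> {1..2 * n}" using that by auto
      \<comment> \<open>The image of one representative determines the block \<open>m\<close> onto
        which block \<open>n\<close> is mapped.\<close>
      obtain m j where mj: "\<phi> (f n 1) = f m j" "1 \<le> m" "j \<in> {1..2 * m}"
        using L_cases[OF \<phi>_L[OF L_intro[OF n1]]] by blast
      have iff: "\<phi> u \<in> ?B m \<longleftrightarrow> u \<in> ?B n" if u: "u \<in> L" for u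
      proof -
        obtain a k b l where e: "u = f a k" "k \<in> {1..2 * a}" "\<phi> u = f b l" "l \<in> {1..2 * b}"
          using L_cases[OF u] L_cases[OF \<phi>_L[OF u]] by blast
        have "d (f b l) (f m j) = d (f a k) (f n 1)"
          using iso[OF u L_intro[OF n1]] e(1,3) mj(1) by simp
        \<comment> \<open>Nearness to a representative characterises a block, and
          \<open>\<phi>\<close> preserves nearness.\<close>
        then have "b = m \<longleftrightarrow> a = n"
          using near[OF e(4) mj(3)] near[OF e(2) n1] by simp
        moreover have "\<phi> u \<in> ?B m \<longleftrightarrow> b = m" "u \<in> ?B n \<longleftrightarrow> a = n"
          using f_eq[OF e(4)] f_eq[OF e(2)] e by (auto simp del: atLeastAtMost_iff)
        ultimately show ?thesis by simp
      qed
      have sub: "?B i \<subseteq> L" for i using L_intro by auto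
      have "\<phi> ` ?B n = ?B m"
      proof
        show "\<phi> ` ?B n \<subseteq> ?B m" using iff sub by blast
        show "?B m \<subseteq> \<phi> ` ?B n"
        proof
          fix v assume v: "v \<in> ?B m"
          then have "v \<in> \<phi> ` L" using sub bij by (auto simp: bij_betw_def)
          then show "v \<in> \<phi> ` ?B n" using v iff by blast
        qed
      qed
      then have bm: "bij_betw \<phi> (?B n) (?B m)"
        by (rule bij_betw_subset[OF bij sub])
      \<comment> \<open>Different blocks have different sizes, so a block can only be mapped onto
        itself.\<close>
      have "card {1..2 * i} = card (?B i)" for i using bij_betw_same_card[OF f_bij] .
      then have "n = m" using bij_betw_same_card[OF bm] by simp
      then show ?thesis using bm by simp
    qed
    \<comment> \<open>\<open>\<phi>\<close> is transported to indices along \<open>f n\<close>. The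
      identity outside the block is demanded by \<open>permutes\<close>, and
      \<open>undefined\<close> at \<open>n = 0\<close> by the extensional product.\<close>
    define \<sigma> where "\<sigma> = (\<lambda>n\<in>{1..}. \<lambda>k. if k \<in> {1..2 * n}
        then inv_into {1..2 * n} (f n) (\<phi> (f n k)) else k)"
    have \<sigma>_perm: "\<sigma> n permutes {1..2 * n}" if "1 \<le> n" for n
    proof (rule bij_imp_permutes)
      have "bij_betw (inv_into {1..2 * n} (f n) \<circ> (\<phi> \<circ> f n)) {1..2 * n} {1..2 * n}"
        using f_bij block[OF that] by (intro bij_betw_trans bij_betw_inv_into)
      then show "bij_betw (\<sigma> n) {1..2 * n} {1..2 * n}"
        by (rule bij_betw_cong[THEN iffD1, rotated]) (use that in \<open>simp add: \<sigma>_def\<close>)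
    qed (use that in \<open>auto simp: \<sigma>_def\<close>)
    have "h \<sigma> u = \<phi> u" for u
    proof (cases "u \<in> L")
      case True
      then obtain n k where u: "u = f n k" "1 \<le> n" "k \<in> {1..2 * n}" using L_cases by blast
      then have "\<phi> u \<in> ?B n" using block[OF u(2)] by (auto simp: bij_betw_def)
      then have "f n (inv_into {1..2 * n} (f n) (\<phi> u)) = \<phi> u" by (rule f_inv_into_f)
      then show ?thesis using u by (simp add: h \<sigma>_def del: atLeastAtMost_iff)
    qed (use ext in \<open>simp add: h_def extensional_def\<close>)
    then have "\<phi> = h \<sigma>" by auto
    moreover have "\<sigma> \<in> carrier ?P"
      using \<sigma>_perm by (auto simp: sym_group_def PiE_iff \<sigma>_def)
    ultimately show ?thesis by blast
  qed
  have "h \<in> iso ?P (isom_group d L)"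
    using h_hom h_inj h_surj h_carrier by (auto simp: iso_def bij_betw_def)
  moreover have "group ?P" by (simp add: sym_group_is_group)
  ultimately show ?thesis by (meson group.iso_sym is_isoI)
qed

theorem theorem6:
  fixes \<gamma> \<theta> :: real
  assumes "\<gamma> > 0" and "\<theta> > 0"
  shows "\<exists>(A :: nat set) (L :: nat list set).
    finite A \<and> regular_language A L \<and>
    isom_group (lev A \<gamma> \<theta>) L \<cong> product_group {1..} (\<lambda>n. sym_group (2 * n))"
proof -
  \<comment> \<open>With \<open>q\<close> this large, \<open>p\<close> replacements cost at least as
    much as two insertions or deletions; adding 2 secures \<open>2 \<le> p\<close>.\<close>
  obtain q :: nat where q: "2 * \<gamma> / \<theta> \<le> real q" using real_arch_simple by blast
  define p where "p = q + 2"
  have p: "2 \<le> p" "2 * \<gamma> \<le> \<theta> * real p"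
    using q assms by (auto simp: p_def field_simps)
  let ?L = "(\<lambda>(n, k). dent p n k) ` (SIGMA n:{1..}. {1..2 * n})"
  \<comment> \<open>Strictness comes from \<open>p\<close> being at least 2, as distinct block
    numbers may differ by only 1.\<close>
  have "2 * \<gamma> < 2 * \<gamma> * real p * \<bar>real n - real m\<bar>" if "n \<noteq> m" for n m :: nat
  proof -
    have "1 \<le> \<bar>real n - real m\<bar>" using that by linarith
    then have "1 < real p * \<bar>real n - real m\<bar>"
      using p(1) mult_mono[of 2 "real p" 1 "\<bar>real n - real m\<bar>"] by simp
    then show ?thesis using assms(1) by simp
  qed
  then have "isom_group (lev {..<p} \<gamma> \<theta>) ?L \<cong> product_group {1..} (\<lambda>n. sym_group (2 * n))"
    using lev_dent[OF assms p] assms(1) by (intro isom_group_blocks[where s = "2 * \<gamma>"]) auto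
  moreover have "regular_language {..<p} ?L" using p by (intro regular_dent_language) simp
  ultimately show ?thesis by blast
qed

end
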